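(* Let $\mathscr{A}$ be a $C^*$-algebra equipped with a $*$-conjugate-automorphism $\sharp$, let $\mathscr{E}$ be a right Hilbert $\mathscr{A}$-module equipped with a $\sharp$-conjugation $C$, and let $T\in\mathbb{L}(\mathscr{E})$ be semiregular. Suppose that $T=U|T|$ is the polar decomposition of $T$, where $U$ is a partial isometry with initial submodule $\overline{\operatorname{ran}(T^* )}$. Then there exists a conjugate-partial isometry $J$ such that (1) $J^*J=P$, where $P:=U^*U$ is the initial projection of $U$; (2) $U=CJ$; (3) $T=CJ|T|$. Moreover, if $U$ is $C$-symmetric, then $J^2=P$ and $JP=PJ=J$.
   Context: A $*$-conjugate-automorphism on a $C^*$-algebra $\mathscr{A}$ is a map $\sharp:\mathscr{A}\to\mathscr{A}$, $a\mapsto a^\sharp$, such that for all $a,b\in\mathscr{A}$, $\lambda\in\mathbb{C}$: (1) $(\lambda a+b)^\sharp=\bar\lambda a^\sharp+b^\sharp$; (2) $(a^\sharp)^\sharp=a$; (3) $(a^\sharp)^*=(a^* )^\sharp$; (4) $(ab)^\sharp=a^\sharp b^\sharp$. Inner products are conjugate-linear in the first variable. $\mathbb{L}(\mathscr{E})$ is the $C^*$-algebra of adjointable linear operators on $\mathscr{E}$. $\mathbb{L}_c(\mathscr{E})$ is the set of bounded conjugate-linear operators $S$ on $\mathscr{E}$ for which there is a bounded conjugate-linear $S^*$ (the $\sharp$-adjoint) with $\langle Sx,y\rangle=\langle x,S^*y\rangle^\sharp$ for all $x,y\in\mathscr{E}$. A $\sharp$-conjugation on $\mathscr{E}$ is a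 bounded conjugate-linear operator $C:\mathscr{E}\to\mathscr{E}$ with $C^2=I_{\mathscr{E}}$ and $\langle Cx,Cy\rangle=\langle x,y\rangle^\sharp$ for all $x,y\in\mathscr{E}$. $U\in\mathbb{L}(\mathscr{E})$ is $C$-symmetric if $U=CU^*C$. $T\in\mathbb{L}(\mathscr{E})$ is semiregular if $\overline{\operatorname{ran}(T)}$ and $\overline{\operatorname{ran}(T^* )}$ are orthogonally complemented. For semiregular $T$ there is a unique partial isometry $U\in\mathbb{L}(\mathscr{E})$ (i.e. $UU^*U=U$) with $T=U|T|$ and $U^*U$ equal to the projection onto $\overline{\operatorname{ran}(T^* )}$; this is the polar decomposition, with $|T|=(T^*T)^{1/2}$. An operator $J\in\mathbb{L}_c(\mathscr{E})$ is a conjugate-partial isometry if $\langle Jx,Jy\rangle=\langle x,y\rangle^\sharp$ for all $x,y\in\ker(J)^\perp$. *)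

theory Defs
  imports "HOL-Analysis.Analysis"
begin

class scaleC =
  fixes scaleC :: "complex \<Rightarrow> 'a \<Rightarrow> 'a"  (infixr "*\<^sub>C" 75)

class complex_banach = banach + scaleC +
  assumes scaleC_add_right: "c *\<^sub>C (x + y) = c *\<^sub>C x + c *\<^sub>C y"
    and scaleC_add_left: "(c + d) *\<^sub>C x = c *\<^sub>C x + d *\<^sub>C x"
    and scaleC_scaleC: "c *\<^sub>C (d *\<^sub>C x) = (c * d) *\<^sub>C x"
    and scaleC_of_real: "complex_of_real r *\<^sub>C x = r *\<^sub>R x"
    and norm_scaleC: "norm (c *\<^sub>C x) = cmod c * norm x"

(* Not necessarily unital. *)
class cstar_algebra = real_normed_algebra + complex_banach +
  fixes star :: "'a \<Rightarrow> 'a"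
  assumes mult_scaleC_left: "(c *\<^sub>C a) * b = c *\<^sub>C (a * b)"
    and mult_scaleC_right: "a * (c *\<^sub>C b) = c *\<^sub>C (a * b)"
    and star_add: "star (a + b) = star a + star b"
    and star_scaleC: "star (c *\<^sub>C a) = cnj c *\<^sub>C star a"
    and star_mult: "star (a * b) = star b * star a"
    and star_star: "star (star a) = a"
    and cstar_identity: "norm (star a * a) = (norm a)\<^sup>2"

definition cstar_positive :: "'a::cstar_algebra \<Rightarrow> bool" where
  "cstar_positive a \<longleftrightarrow> (\<exists>b. a = star b * b)"

definition star_conjugate_automorphism :: "('a::cstar_algebra \<Rightarrow> 'a) \<Rightarrow> bool" where
  "star_conjugate_automorphism sharp \<longleftrightarrow>
     (\<forall>a b c. sharp (c *\<^sub>C a + b) = cnj c *\<^sub>C sharp a + sharp b) \<and>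
     (\<forall>a. sharp (sharp a) = a) \<and>
     (\<forall>a. star (sharp a) = sharp (star a)) \<and>
     (\<forall>a b. sharp (a * b) = sharp a * sharp b)"

(* Right module action act and A-valued inner product ip. The Banach space norm of the
   carrier type is required to be the one induced by ip, so the completeness in
   complex_banach is completeness of the Hilbert module. Conjugate linearity of ip in the
   first variable follows from ip_linear and ip_star. *)
locale hilbert_module =
  fixes act :: "'e::complex_banach \<Rightarrow> 'a::cstar_algebra \<Rightarrow> 'e"
    and ip :: "'e \<Rightarrow> 'e \<Rightarrow> 'a"
  assumes act_add_left: "act (x + y) a = act x a + act y a"
    and act_add_right: "act x (a + b) = act x a + act x b"
    and act_mult: "act x (a * b) = act (act x a) b"
    and act_scaleC_left: "act (c *\<^sub>C x) a = c *\<^sub>C act x a"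
    and act_scaleC_right: "act x (c *\<^sub>C a) = c *\<^sub>C act x a"
    and ip_linear: "ip x (c *\<^sub>C y + z) = c *\<^sub>C ip x y + ip x z"
    and ip_act: "ip x (act y a) = ip x y * a"
    and ip_star: "star (ip x y) = ip y x"
    and ip_positive: "cstar_positive (ip x x)"
    and ip_definite: "ip x x = 0 \<Longrightarrow> x = 0"
    and norm_ip: "norm x = sqrt (norm (ip x x))"

definition adjointable_ops ::
    "('e::complex_banach \<Rightarrow> 'e \<Rightarrow> 'a::cstar_algebra) \<Rightarrow> ('e \<Rightarrow> 'e) set" where
  "adjointable_ops ip =
     {T. Vector_Spaces.linear (*\<^sub>C) (*\<^sub>C) T \<and> (\<exists>S. \<forall>x y. ip (T x) y = ip x (S y))}"

(* Unique for T in adjointable_ops ip, as ip is definite. *)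
definition adjoint_op ::
    "('e::complex_banach \<Rightarrow> 'e \<Rightarrow> 'a::cstar_algebra) \<Rightarrow> ('e \<Rightarrow> 'e) \<Rightarrow> 'e \<Rightarrow> 'e" where
  "adjoint_op ip T = (THE S. \<forall>x y. ip (T x) y = ip x (S y))"

(* Positivity in the C*-algebra of adjointable operators. *)
definition positive_op ::
    "('e::complex_banach \<Rightarrow> 'e \<Rightarrow> 'a::cstar_algebra) \<Rightarrow> ('e \<Rightarrow> 'e) \<Rightarrow> bool" where
  "positive_op ip A \<longleftrightarrow> (\<exists>R\<in>adjointable_ops ip. A = adjoint_op ip R \<circ> R)"

(* The unique positive square root of T*T in the C*-algebra of adjointable operators. *)
definition abs_op ::
    "('e::complex_banach \<Rightarrow> 'e \<Rightarrow> 'a::cstar_algebra) \<Rightarrow> ('e \<Rightarrow> 'e) \<Rightarrow> 'e \<Rightarrow> 'e" where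
  "abs_op ip T = (THE A. positive_op ip A \<and> A \<circ> A = adjoint_op ip T \<circ> T)"

definition orth_compl ::
    "('e::complex_banach \<Rightarrow> 'e \<Rightarrow> 'a::cstar_algebra) \<Rightarrow> 'e set \<Rightarrow> 'e set" where
  "orth_compl ip M = {x. \<forall>y\<in>M. ip x y = 0}"

definition orth_complemented ::
    "('e::complex_banach \<Rightarrow> 'e \<Rightarrow> 'a::cstar_algebra) \<Rightarrow> 'e set \<Rightarrow> bool" where
  "orth_complemented ip M \<longleftrightarrow> (\<forall>x. \<exists>m\<in>M. \<exists>n\<in>orth_compl ip M. x = m + n)"

definition semiregular ::
    "('e::complex_banach \<Rightarrow> 'e \<Rightarrow> 'a::cstar_algebra) \<Rightarrow> ('e \<Rightarrow> 'e) \<Rightarrow> bool" where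
  "semiregular ip T \<longleftrightarrow> T \<in> adjointable_ops ip \<and>
     orth_complemented ip (closure (range T)) \<and>
     orth_complemented ip (closure (range (adjoint_op ip T)))"

definition partial_isometry ::
    "('e::complex_banach \<Rightarrow> 'e \<Rightarrow> 'a::cstar_algebra) \<Rightarrow> ('e \<Rightarrow> 'e) \<Rightarrow> bool" where
  "partial_isometry ip U \<longleftrightarrow> U \<in> adjointable_ops ip \<and> U \<circ> adjoint_op ip U \<circ> U = U"

definition projection_onto ::
    "('e::complex_banach \<Rightarrow> 'e \<Rightarrow> 'a::cstar_algebra) \<Rightarrow> ('e \<Rightarrow> 'e) \<Rightarrow> 'e set \<Rightarrow> bool" where
  "projection_onto ip P M \<longleftrightarrow>
     P \<in> adjointable_ops ip \<and> adjoint_op ip P = P \<and> P \<circ> P = P \<and> range P = M"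

definition polar_decomposition ::
    "('e::complex_banach \<Rightarrow> 'e \<Rightarrow> 'a::cstar_algebra) \<Rightarrow> ('e \<Rightarrow> 'e) \<Rightarrow> ('e \<Rightarrow> 'e) \<Rightarrow> bool" where
  "polar_decomposition ip T U \<longleftrightarrow>
     partial_isometry ip U \<and> T = U \<circ> abs_op ip T \<and>
     projection_onto ip (adjoint_op ip U \<circ> U) (closure (range (adjoint_op ip T)))"

definition bounded_conjugate_linear :: "('e::complex_banach \<Rightarrow> 'e) \<Rightarrow> bool" where
  "bounded_conjugate_linear S \<longleftrightarrow>
     (\<forall>x y. S (x + y) = S x + S y) \<and>
     (\<forall>c x. S (c *\<^sub>C x) = cnj c *\<^sub>C S x) \<and>
     (\<exists>K. \<forall>x. norm (S x) \<le> K * norm x)"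

definition conj_adjointable_ops ::
    "('e::complex_banach \<Rightarrow> 'e \<Rightarrow> 'a::cstar_algebra) \<Rightarrow> ('a \<Rightarrow> 'a) \<Rightarrow> ('e \<Rightarrow> 'e) set" where
  "conj_adjointable_ops ip sharp =
     {S. bounded_conjugate_linear S \<and>
         (\<exists>R. bounded_conjugate_linear R \<and> (\<forall>x y. ip (S x) y = sharp (ip x (R y))))}"

definition sharp_adjoint ::
    "('e::complex_banach \<Rightarrow> 'e \<Rightarrow> 'a::cstar_algebra) \<Rightarrow> ('a \<Rightarrow> 'a) \<Rightarrow> ('e \<Rightarrow> 'e) \<Rightarrow> 'e \<Rightarrow> 'e" where
  "sharp_adjoint ip sharp S =
     (THE R. bounded_conjugate_linear R \<and> (\<forall>x y. ip (S x) y = sharp (ip x (R y))))"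

definition sharp_conjugation ::
    "('e::complex_banach \<Rightarrow> 'e \<Rightarrow> 'a::cstar_algebra) \<Rightarrow> ('a \<Rightarrow> 'a) \<Rightarrow> ('e \<Rightarrow> 'e) \<Rightarrow> bool" where
  "sharp_conjugation ip sharp C \<longleftrightarrow>
     bounded_conjugate_linear C \<and> C \<circ> C = id \<and>
     (\<forall>x y. ip (C x) (C y) = sharp (ip x y))"

definition C_symmetric ::
    "('e::complex_banach \<Rightarrow> 'e \<Rightarrow> 'a::cstar_algebra) \<Rightarrow> ('e \<Rightarrow> 'e) \<Rightarrow> ('e \<Rightarrow> 'e) \<Rightarrow> bool" where
  "C_symmetric ip C U \<longleftrightarrow> U = C \<circ> adjoint_op ip U \<circ> C"

definition conjugate_partial_isometry ::
    "('e::complex_banach \<Rightarrow> 'e \<Rightarrow> 'a::cstar_algebra) \<Rightarrow> ('a \<Rightarrow> 'a) \<Rightarrow> ('e \<Rightarrow> 'e) \<Rightarrow> bool" where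
  "conjugate_partial_isometry ip sharp J \<longleftrightarrow>
     J \<in> conj_adjointable_ops ip sharp \<and>
     (\<forall>x\<in>orth_compl ip {z. J z = 0}. \<forall>y\<in>orth_compl ip {z. J z = 0}.
        ip (J x) (J y) = sharp (ip x y))"

end

(* Take J = C o U.  Then the sharp-adjoint of J is U* o C, and all the identities follow from
   C o C = id; C-symmetry of U says C o U = U* o C.  The boundedness of U and U* is
   obtained from a Cauchy-Schwarz inequality with constant 4: polarization and the triangle
   inequality of the Hilbert module norm suffice for it, so no order theory of the C*-algebra
   is needed. *)
theory Submission imports Defs begin

lemma scaleC_one [simp]: "1 *\<^sub>C (x::'a::complex_banach) = x"
  using scaleC_of_real[of 1 x] by simp

lemma scaleC_minus_one: "(- 1) *\<^sub>C (x::'a::complex_banach) = - x"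
  using scaleC_of_real[of "-1" x] by simp

lemma star_diff: "star (a - b) = star a - star (b::'a::cstar_algebra)"
  using star_add[of "a - b" b] by (simp add: algebra_simps)

context hilbert_module
begin

lemma ip_add_right: "ip x (y + z) = ip x y + ip x z"
  using ip_linear[of x 1 y z] by simp

lemma ip_zero_right [simp]: "ip x 0 = 0"
  using ip_add_right[of x 0 0] by simp

lemma ip_scaleC_right: "ip x (c *\<^sub>C y) = c *\<^sub>C ip x y"
  using ip_linear[of x c y 0] by simp

lemma ip_diff_right: "ip x (y - z) = ip x y - ip x z"
  using ip_add_right[of x "y - z" z] by (simp add: algebra_simps)

lemma ip_add_left: "ip (x + y) z = ip x z + ip y z"
  by (metis ip_star ip_add_right star_add)

lemma ip_diff_left: "ip (x - y) z = ip x z - ip y z"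
  by (metis ip_star ip_diff_right star_diff)

lemma ip_scaleC_left: "ip (c *\<^sub>C x) y = cnj c *\<^sub>C ip x y"
  by (metis ip_star ip_scaleC_right star_scaleC)

lemma ip_scaleR_left: "ip (r *\<^sub>R x) y = r *\<^sub>R ip x y"
  using ip_scaleC_left[of "complex_of_real r" x y] by (simp add: scaleC_of_real)

lemma ip_scaleR_right: "ip x (r *\<^sub>R y) = r *\<^sub>R ip x y"
  using ip_scaleC_right[of x "complex_of_real r" y] by (simp add: scaleC_of_real)

lemma norm_ip_same: "norm (ip x x) = (norm x)\<^sup>2"
  by (simp add: norm_ip)

text \<open>Definiteness, applied with the test vector \<open>x = y - z\<close>. Operator identities
  below are checked weakly through this rule.\<close>

lemma ip_eqI:
  assumes "\<And>x. ip x y = ip x z"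
  shows "y = z"
  using assms[of "y - z"] ip_definite[of "y - z"] by (simp add: ip_diff_right)

text \<open>\<open>ip x y\<close> is half the sum of \<open>ip x y + ip y x\<close> and
  \<open>ip x y - ip y x\<close>. Polarization bounds the first by 4, and the second is the first
  for a rotated \<open>y\<close>.\<close>

lemma norm_ip_le_unit:
  assumes x: "norm x = 1" and y: "norm y = 1"
  shows "norm (ip x y) \<le> 4"
proof -
  have sym: "norm (ip x z + ip z x) \<le> 4" if "norm z = 1" for z
  proof -
    have "2 *\<^sub>R (ip x z + ip z x) = ip (x + z) (x + z) - ip (x - z) (x - z)"
      by (simp add: ip_add_left ip_add_right ip_diff_left ip_diff_right scaleR_2)
    then have "2 * norm (ip x z + ip z x) = norm (ip (x + z) (x + z) - ip (x - z) (x - z))"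
      by (metis norm_scaleR abs_numeral)
    also have "\<dots> \<le> (norm (x + z))\<^sup>2 + (norm (x - z))\<^sup>2"
      by (metis norm_ip_same norm_triangle_ineq4)
    also have "\<dots> \<le> 2\<^sup>2 + 2\<^sup>2"
      using norm_triangle_ineq[of x z] norm_triangle_ineq4[of x z] x that
      by (intro add_mono power_mono) auto
    finally show ?thesis by simp
  qed
  \<comment> \<open>Since \<open>ip\<close> is conjugate-linear on the left, replacing
    \<open>y\<close> by \<open>\<i> *\<^sub>C y\<close> turns the sum in \<open>sym\<close> into
    \<open>\<i>\<close> times the difference.\<close>
  have "norm (\<i> *\<^sub>C y) = 1"
    using y by (simp add: norm_scaleC)
  from sym[OF this] have "norm (\<i> *\<^sub>C (ip x y - ip y x)) \<le> 4"
  proof -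
    have "ip x (\<i> *\<^sub>C y) + ip (\<i> *\<^sub>C y) x = \<i> *\<^sub>C (ip x y + (- 1) *\<^sub>C ip y x)"
      by (simp add: ip_scaleC_left ip_scaleC_right scaleC_add_right scaleC_scaleC)
    with \<open>norm (ip x (\<i> *\<^sub>C y) + ip (\<i> *\<^sub>C y) x) \<le> 4\<close> show ?thesis
      by (simp add: scaleC_minus_one)
  qed
  then have "norm (ip x y - ip y x) \<le> 4"
    by (simp add: norm_scaleC)
  moreover have "2 *\<^sub>R ip x y = (ip x y + ip y x) + (ip x y - ip y x)"
    by (simp add: scaleR_2)
  then have "2 * norm (ip x y) \<le> norm (ip x y + ip y x) + norm (ip x y - ip y x)"
    by (metis norm_scaleR abs_numeral norm_triangle_ineq)
  ultimately show ?thesis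
    using sym[OF y] by simp
qed

lemma norm_ip_le: "norm (ip x y) \<le> 4 * norm x * norm y"
proof (cases "x = 0 \<or> y = 0")
  case True
  then show ?thesis
    using ip_scaleR_left[of 0 x y] by auto
next
  case False
  have "norm (ip (inverse (norm x) *\<^sub>R x) (inverse (norm y) *\<^sub>R y)) \<le> 4"
    using False by (intro norm_ip_le_unit) auto
  then show ?thesis
    using False by (simp add: ip_scaleR_left ip_scaleR_right field_simps)
qed

text \<open>Definiteness leaves at most one candidate for the adjoint, so the definite description
  picks the one that membership provides.\<close>

lemma adjoint_op_ip:
  assumes "V \<in> adjointable_ops ip"
  shows "ip (V x) y = ip x (adjoint_op ip V y)"
proof -
  obtain S where S: "\<forall>x y. ip (V x) y = ip x (S y)"
    using assms unfolding adjointable_ops_def by blast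
  have "adjoint_op ip V = S"
    unfolding adjoint_op_def
  proof (rule the_equality)
    show "\<forall>x y. ip (V x) y = ip x (S y)"
      by (fact S)
  next
    fix R
    assume "\<forall>x y. ip (V x) y = ip x (R y)"
    with S show "R = S"
      by (intro ext ip_eqI) metis
  qed
  with S show ?thesis by simp
qed

lemma adjoint_op_ip_left:
  assumes "V \<in> adjointable_ops ip"
  shows "ip (adjoint_op ip V x) y = ip x (V y)"
  by (metis adjoint_op_ip[OF assms] ip_star)

text \<open>Linearity is read off from the adjoint relation: moving \<open>V\<close> across
  \<open>ip\<close> leaves a sum in the right argument, where \<open>ip\<close> is additive.\<close>

lemma adjointable_add: "V \<in> adjointable_ops ip \<Longrightarrow> V (x + y) = V x + V y"
  by (intro ip_eqI) (simp add: adjoint_op_ip_left[symmetric] ip_add_right)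

lemma adjointable_diff: "V \<in> adjointable_ops ip \<Longrightarrow> V (x - y) = V x - V y"
  by (intro ip_eqI) (simp add: adjoint_op_ip_left[symmetric] ip_diff_right)

lemma adjointable_scaleC: "V \<in> adjointable_ops ip \<Longrightarrow> V (c *\<^sub>C x) = c *\<^sub>C V x"
  by (intro ip_eqI) (simp add: adjoint_op_ip_left[symmetric] ip_scaleC_right)

lemma adjoint_op_add:
  "V \<in> adjointable_ops ip \<Longrightarrow> adjoint_op ip V (x + y) = adjoint_op ip V x + adjoint_op ip V y"
  by (intro ip_eqI) (simp add: adjoint_op_ip[symmetric] ip_add_right)

lemma adjoint_op_scaleC:
  "V \<in> adjointable_ops ip \<Longrightarrow> adjoint_op ip V (c *\<^sub>C x) = c *\<^sub>C adjoint_op ip V x"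
  by (intro ip_eqI) (simp add: adjoint_op_ip[symmetric] ip_scaleC_right)

lemma partial_isometry_apply:
  "partial_isometry ip U \<Longrightarrow> U (adjoint_op ip U (U x)) = U x"
  unfolding partial_isometry_def by (metis comp_apply)

text \<open>With \<open>p\<close> the image of \<open>x\<close> under the initial projection,
  \<open>ip (U x) (U x)\<close>, \<open>ip x p\<close> and \<open>ip p p\<close> coincide.
  Cauchy-Schwarz for \<open>x\<close> and \<open>p\<close> then leaves a factor
  \<open>norm (U x)\<close> to cancel.\<close>

lemma partial_isometry_norm_le:
  assumes "partial_isometry ip U"
  shows "norm (U x) \<le> 4 * norm x"
proof -
  have U: "U \<in> adjointable_ops ip"
    using assms by (simp add: partial_isometry_def)
  define p where "p = adjoint_op ip U (U x)"
  have Ux: "ip (U x) (U x) = ip x p"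
    unfolding p_def by (rule adjoint_op_ip[OF U])
  have "ip p p = ip x p"
    unfolding p_def
    by (simp add: adjoint_op_ip_left[OF U] partial_isometry_apply[OF assms] adjoint_op_ip[OF U])
  with Ux have eq: "norm p = norm (U x)"
    by (simp add: norm_ip)
  have "norm (U x) * norm (U x) \<le> (4 * norm x) * norm (U x)"
    using norm_ip_le[of x p] Ux eq norm_ip_same[of "U x"] by (simp add: power2_eq_square)
  then show ?thesis
    by (cases "U x = 0") (auto simp: mult_le_cancel_right)
qed

lemma adjoint_op_norm_le:
  assumes V: "V \<in> adjointable_ops ip" and K: "\<And>x. norm (V x) \<le> K * norm x"
  shows "norm (adjoint_op ip V y) \<le> 4 * K * norm y"
proof -
  let ?z = "adjoint_op ip V y"
  have "norm ?z * norm ?z = norm (ip (V ?z) y)"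
    by (simp add: adjoint_op_ip[OF V] norm_ip_same power2_eq_square)
  also have "\<dots> \<le> 4 * norm (V ?z) * norm y"
    by (rule norm_ip_le)
  also have "\<dots> \<le> 4 * (K * norm ?z) * norm y"
    by (intro mult_right_mono mult_left_mono K) auto
  finally have "norm ?z * norm ?z \<le> (4 * K * norm y) * norm ?z"
    by (simp add: ac_simps)
  \<comment> \<open>The sign of \<open>K\<close> is not prescribed; this settles the case
    \<open>?z = 0\<close>, where nothing can be cancelled.\<close>
  moreover have "0 \<le> K * norm y"
    using K[of y] norm_ge_zero[of "V y"] by linarith
  ultimately show ?thesis
    by (cases "?z = 0") (auto simp: mult_le_cancel_right)
qed

text \<open>The defect \<open>?d\<close> lies in the kernel of \<open>U\<close>, hence is orthogonal
  both to \<open>y\<close> and to the range of the adjoint, and so to itself.\<close>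

lemma partial_isometry_initial_projection:
  assumes "partial_isometry ip U" and y: "y \<in> orth_compl ip {z. U z = 0}"
  shows "adjoint_op ip U (U y) = y"
proof -
  have U: "U \<in> adjointable_ops ip"
    using assms by (simp add: partial_isometry_def)
  let ?d = "y - adjoint_op ip U (U y)"
  have d: "U ?d = 0"
    by (simp add: adjointable_diff[OF U] partial_isometry_apply[OF assms(1)])
  have "ip ?d ?d = 0"
    using y d unfolding orth_compl_def
    by (simp add: ip_diff_left[of y _ ?d] adjoint_op_ip_left[OF U])
  then show ?thesis
    using ip_definite[of ?d] by simp
qed

text \<open>Because \<open>sharp\<close> is an involution it can be stripped from the defining
  relation, and definiteness gives uniqueness.\<close>

lemma sharp_adjoint_eqI:
  assumes "star_conjugate_automorphism sharp" and "bounded_conjugate_linear R"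
    and R: "\<And>x y. ip (S x) y = sharp (ip x (R y))"
  shows "sharp_adjoint ip sharp S = R"
  unfolding sharp_adjoint_def
proof (rule the_equality)
  show "bounded_conjugate_linear R \<and> (\<forall>x y. ip (S x) y = sharp (ip x (R y)))"
    using assms by blast
next
  fix R'
  assume R': "bounded_conjugate_linear R' \<and> (\<forall>x y. ip (S x) y = sharp (ip x (R' y)))"
  have "sharp (sharp a) = a" for a
    using assms(1) unfolding star_conjugate_automorphism_def by blast
  with R R' have "ip x (R' y) = ip x (R y)" for x y
    by metis
  then show "R' = R"
    by (intro ext ip_eqI)
qed

end

theorem theorem5p7:
  fixes act :: "'e::complex_banach \<Rightarrow> 'a::cstar_algebra \<Rightarrow> 'e"
    and ip :: "'e \<Rightarrow> 'e \<Rightarrow> 'a"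
    and sharp :: "'a \<Rightarrow> 'a"
    and C T U P :: "'e \<Rightarrow> 'e"
  assumes "hilbert_module act ip"
    and "star_conjugate_automorphism sharp"
    and "sharp_conjugation ip sharp C"
    and "T \<in> adjointable_ops ip"
    and "semiregular ip T"
    and "polar_decomposition ip T U"
    and "P = adjoint_op ip U \<circ> U"
  shows "\<exists>J. conjugate_partial_isometry ip sharp J \<and>
    sharp_adjoint ip sharp J \<circ> J = P \<and>
    U = C \<circ> J \<and>
    T = C \<circ> J \<circ> abs_op ip T \<and>
    (C_symmetric ip C U \<longrightarrow> J \<circ> J = P \<and> J \<circ> P = J \<and> P \<circ> J = J)"
proof -
  interpret hilbert_module act ip by fact
  have iso: "partial_isometry ip U" and T: "T = U \<circ> abs_op ip T"
    using assms(6) by (auto simp: polar_decomposition_def)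
  then have U: "U \<in> adjointable_ops ip"
    by (simp add: partial_isometry_def)
  let ?U' = "adjoint_op ip U"
  have CC: "C (C x) = x" for x
    using assms(3) unfolding sharp_conjugation_def by (metis comp_apply id_apply)
  have C_ip: "ip (C x) (C y) = sharp (ip x y)" for x y
    using assms(3) unfolding sharp_conjugation_def by blast
  have C_add: "C (x + y) = C x + C y" and C_scaleC: "C (c *\<^sub>C x) = cnj c *\<^sub>C C x" for x y c
    using assms(3) unfolding sharp_conjugation_def bounded_conjugate_linear_def by blast+
  obtain K where K: "\<And>x. norm (C x) \<le> K * norm x"
    using assms(3) unfolding sharp_conjugation_def bounded_conjugate_linear_def by blast
  \<comment> \<open>This identifies the kernel of \<open>C \<circ> U\<close> with that of
    \<open>U\<close>.\<close>
  have C_zero: "C x = 0 \<longleftrightarrow> x = 0" for x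
    by (metis CC C_add add_cancel_right_right)

  let ?J = "C \<circ> U" and ?R = "?U' \<circ> C"
  have "norm (C (U x)) \<le> (\<bar>K\<bar> * 4) * norm x" for x
  proof -
    have "norm (C (U x)) \<le> \<bar>K\<bar> * norm (U x)"
      using K[of "U x"] mult_right_mono[OF abs_ge_self[of K], of "norm (U x)"] by simp
    also have "\<dots> \<le> \<bar>K\<bar> * (4 * norm x)"
      by (intro mult_left_mono partial_isometry_norm_le iso) simp
    finally show ?thesis by simp
  qed
  then have J: "bounded_conjugate_linear ?J"
    unfolding bounded_conjugate_linear_def
    by (auto simp: C_add C_scaleC adjointable_add[OF U] adjointable_scaleC[OF U])
  \<comment> \<open>The 16 is 4 from the bound on \<open>U\<close> times 4 from Cauchy-Schwarz when
    passing to the adjoint.\<close>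
  have "norm (?U' (C x)) \<le> (16 * K) * norm x" for x
    using adjoint_op_norm_le[OF U partial_isometry_norm_le[OF iso], of "C x"] K[of x] by simp
  then have R: "bounded_conjugate_linear ?R"
    unfolding bounded_conjugate_linear_def
    by (auto simp: C_add C_scaleC adjoint_op_add[OF U] adjoint_op_scaleC[OF U])
  \<comment> \<open>Writing \<open>y\<close> as \<open>C (C y)\<close> puts \<open>C\<close> in both
    arguments, so that \<open>C_ip\<close> applies.\<close>
  have JR: "ip (?J x) y = sharp (ip x (?R y))" for x y
    using C_ip[of "U x" "C y"] by (simp add: CC adjoint_op_ip[OF U])

  \<comment> \<open>After \<open>C\<close> is removed, \<open>U\<close> is moved to the right
    argument, where the initial projection fixes \<open>y\<close>.\<close>
  have "ip (?J x) (?J y) = sharp (ip x y)" if "y \<in> orth_compl ip {z. ?J z = 0}" for x y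
    using that by (simp add: C_ip C_zero adjoint_op_ip[OF U] partial_isometry_initial_projection[OF iso])
  with J R JR have "conjugate_partial_isometry ip sharp ?J"
    unfolding conjugate_partial_isometry_def conj_adjointable_ops_def by blast
  moreover have "sharp_adjoint ip sharp ?J \<circ> ?J = P"
    by (simp add: sharp_adjoint_eqI[OF assms(2) R JR] assms(7) fun_eq_iff CC)
  moreover have CJ: "U = C \<circ> ?J"
    by (simp add: fun_eq_iff CC)
  moreover have "T = C \<circ> ?J \<circ> abs_op ip T"
    using T CJ by metis
  moreover have "?J \<circ> ?J = P \<and> ?J \<circ> P = ?J \<and> P \<circ> ?J = ?J" if "C_symmetric ip C U"
  proof -
    have "U x = C (?U' (C x))" for x
      using that unfolding C_symmetric_def by (metis comp_apply)
    then have CU: "C (U x) = ?U' (C x)" for x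
      by (metis CC)
    have JJ: "?J \<circ> ?J = P"
      by (simp add: fun_eq_iff assms(7) CC CU[of "C (U _)"])
    have JP: "?J \<circ> P = ?J"
      by (simp add: fun_eq_iff assms(7) partial_isometry_apply[OF iso])
    \<comment> \<open>As \<open>P\<close> is the square of \<open>?J\<close>, it commutes with
      \<open>?J\<close> by associativity.\<close>
    have "P \<circ> ?J = ?J \<circ> P"
      unfolding JJ[symmetric] by (simp only: o_assoc)
    with JJ JP show ?thesis by simp
  qed
  ultimately show ?thesis by blast
qed

end
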